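(* Assume the standing setup below. Then $A\setminus X$ admits no partition $A\setminus X=\{a',a\}\cup A_1\cup A_2$ (disjoint union) in which $a'$ covers $a$, every element of $A_1$ is above or incomparable to $a'$, every element of $A_2$ is below or incomparable to $a$, and $A_1$ and $A_2$ are both non-empty. The same holds for $C\setminus X$.
   Context: Standing setup: $\Gamma_n=\{A,B,C\}$ is a set of three pairwise non-isomorphic posets of size $n$, and $Q$ is a witness of $\Gamma_n$ (the set of isomorphism classes of downsets of $Q$ of size $n$ is exactly $\Gamma_n$). $G_n(Q)$ is the exchange graph: vertices are all downsets of $Q$ of size $n$ (as subsets), adjacent when they differ by exactly one element. A special path is a path $v_0,\ldots,v_r$ ($r\ge2$) in $G_n(Q)$ whose first vertex, internal vertices, and last vertex are isomorphic to three distinct members of $\Gamma_n$ respectively (all internal vertices isomorphic to the same member). Fix a special path of minimal length among all special paths in $G_n(Q)$, labelled so that $v_0\cong A$, $v_1,\ldots,v_{r-1}\cong B$, $v_r\cong C$; $A:=v_0$, $C:=v_r$ denote these specific downsets (anchor copies). Assume $Q$ equals the union of the vertices of this path. Let $X=A\cap C$ and $m=|A\setminus X|=|C\setminus X|$. Cover relations and comparabilities are those of $Q$. *)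

theory Defs
  imports Main
begin

text \<open>A finite poset is modelled as a carrier set with a relation (only its
restriction to the carrier matters).\<close>

definition is_poset :: "'a set \<Rightarrow> ('a \<Rightarrow> 'a \<Rightarrow> bool) \<Rightarrow> bool" where
  "is_poset S r \<longleftrightarrow> (\<forall>x\<in>S. r x x) \<and>
     (\<forall>x\<in>S. \<forall>y\<in>S. r x y \<and> r y x \<longrightarrow> x = y) \<and>
     (\<forall>x\<in>S. \<forall>y\<in>S. \<forall>z\<in>S. r x y \<and> r y z \<longrightarrow> r x z)"

definition ord_iso :: "'a set \<Rightarrow> ('a \<Rightarrow> 'a \<Rightarrow> bool) \<Rightarrow> 'b set \<Rightarrow> ('b \<Rightarrow> 'b \<Rightarrow> bool) \<Rightarrow> bool" where
  "ord_iso D r E s \<longleftrightarrow> (\<exists>f. bij_betw f D E \<and> (\<forall>x\<in>D. \<forall>y\<in>D. r x y \<longleftrightarrow> s (f x) (f y)))"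

definition downset :: "'a set \<Rightarrow> ('a \<Rightarrow> 'a \<Rightarrow> bool) \<Rightarrow> 'a set \<Rightarrow> bool" where
  "downset Q le D \<longleftrightarrow> D \<subseteq> Q \<and> (\<forall>x\<in>D. \<forall>y\<in>Q. le y x \<longrightarrow> y \<in> D)"

definition exch_vertices :: "'a set \<Rightarrow> ('a \<Rightarrow> 'a \<Rightarrow> bool) \<Rightarrow> nat \<Rightarrow> 'a set set" where
  "exch_vertices Q le n = {D. downset Q le D \<and> card D = n}"

definition exch_adj :: "'a set \<Rightarrow> 'a set \<Rightarrow> bool" where
  "exch_adj D E \<longleftrightarrow> card (D - E) = 1 \<and> card (E - D) = 1"

definition is_witness :: "'a set \<Rightarrow> ('a \<Rightarrow> 'a \<Rightarrow> bool) \<Rightarrow> nat \<Rightarrow> ('b set \<times> ('b \<Rightarrow> 'b \<Rightarrow> bool)) set \<Rightarrow> bool" where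
  "is_witness Q le n \<Gamma> \<longleftrightarrow>
     (\<forall>D\<in>exch_vertices Q le n. \<exists>P\<in>\<Gamma>. ord_iso D le (fst P) (snd P)) \<and>
     (\<forall>P\<in>\<Gamma>. \<exists>D\<in>exch_vertices Q le n. ord_iso D le (fst P) (snd P))"

text \<open>A special path v_0,...,v_r (r >= 2), given as the list of its vertices.\<close>
definition special_path :: "'a set \<Rightarrow> ('a \<Rightarrow> 'a \<Rightarrow> bool) \<Rightarrow> nat \<Rightarrow> ('b set \<times> ('b \<Rightarrow> 'b \<Rightarrow> bool)) set \<Rightarrow> 'a set list \<Rightarrow> bool" where
  "special_path Q le n \<Gamma> vs \<longleftrightarrow>
     length vs \<ge> 3 \<and> distinct vs \<and> set vs \<subseteq> exch_vertices Q le n \<and>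
     (\<forall>i. Suc i < length vs \<longrightarrow> exch_adj (vs ! i) (vs ! Suc i)) \<and>
     (\<exists>P1\<in>\<Gamma>. \<exists>P2\<in>\<Gamma>. \<exists>P3\<in>\<Gamma>. P1 \<noteq> P2 \<and> P2 \<noteq> P3 \<and> P1 \<noteq> P3 \<and>
        ord_iso (hd vs) le (fst P1) (snd P1) \<and>
        (\<forall>i. 0 < i \<and> i < length vs - 1 \<longrightarrow> ord_iso (vs ! i) le (fst P2) (snd P2)) \<and>
        ord_iso (last vs) le (fst P3) (snd P3))"

definition covers :: "'a set \<Rightarrow> ('a \<Rightarrow> 'a \<Rightarrow> bool) \<Rightarrow> 'a \<Rightarrow> 'a \<Rightarrow> bool" where
  "covers Q le a' a \<longleftrightarrow> a \<in> Q \<and> a' \<in> Q \<and> le a a' \<and> a \<noteq> a' \<and>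
     \<not> (\<exists>z\<in>Q. le a z \<and> le z a' \<and> z \<noteq> a \<and> z \<noteq> a')"

definition incomparable :: "('a \<Rightarrow> 'a \<Rightarrow> bool) \<Rightarrow> 'a \<Rightarrow> 'a \<Rightarrow> bool" where
  "incomparable le x y \<longleftrightarrow> \<not> le x y \<and> \<not> le y x"

definition bad_partition :: "'a set \<Rightarrow> ('a \<Rightarrow> 'a \<Rightarrow> bool) \<Rightarrow> 'a set \<Rightarrow> bool" where
  "bad_partition Q le S \<longleftrightarrow> (\<exists>a' a A1 A2.
     a' \<noteq> a \<and> a' \<notin> A1 \<and> a' \<notin> A2 \<and> a \<notin> A1 \<and> a \<notin> A2 \<and> A1 \<inter> A2 = {} \<and>
     S = {a', a} \<union> A1 \<union> A2 \<and>
     covers Q le a' a \<and>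
     (\<forall>x\<in>A1. le a' x \<or> incomparable le x a') \<and>
     (\<forall>x\<in>A2. le x a \<or> incomparable le x a) \<and>
     A1 \<noteq> {} \<and> A2 \<noteq> {})"

end

theory Submission
  imports Defs
begin

text \<open>
  Let \<open>A\<close> and \<open>C\<close> be the ends of the minimal special path, \<open>X = A \<inter> C\<close> and
  \<open>m = |A - C|\<close>. Call a vertex \<open>D\<close> of \<open>G_n(Q)\<close> between \<open>A\<close> and \<open>C\<close> if
  \<open>X \<subseteq> D \<subseteq> A \<union> C\<close>, with level \<open>|D - A|\<close>. Two componentwise comparable such vertices lie on a
  monotone path from \<open>A\<close> to \<open>C\<close>, which has length \<open>m \<le> r\<close>; by minimality of the special path,
  once one interior vertex of such a path has the middle class \<open>B\<close>, all of them do. If \<open>v\<^sub>1\<close>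
  were not between \<open>A\<close> and \<open>C\<close>, then \<open>v\<^sub>1\<close> followed by a monotone path from \<open>A\<close> to \<open>C\<close> would
  be too short. So \<open>v\<^sub>1\<close> is between, and then every vertex between \<open>A\<close> and \<open>C\<close> of level
  \<open>1, \<dots>, m - 2\<close> has class \<open>B\<close>.

  A forbidden partition yields \<open>a'\<close> covering \<open>a\<close> in \<open>A - C\<close> and \<open>z, w \<in> A - C\<close> with \<open>a\<close>
  not below \<open>z\<close> and \<open>w\<close> below neither \<open>a'\<close> nor \<open>z\<close>. Start from the vertex \<open>D\<^sub>1\<close> between
  \<open>A\<close> and \<open>C\<close> with \<open>D\<^sub>1 \<inter> A = A \<inter> (C \<union> \<down>a' \<union> \<down>z)\<close> and exchange first \<open>a'\<close>, then \<open>a\<close> for the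
  two elements \<open>t\<^sub>1, t\<^sub>2\<close> of least height in \<open>C - D\<^sub>1\<close>. All three vertices have class \<open>B\<close>,
  hence the same number of comparable pairs, while removing a maximal element \<open>x\<close> from a
  downset removes exactly \<open>|\<down>x|\<close> pairs. Thus \<open>|\<down>a'| = |\<down>t\<^sub>1| \<le> |\<down>t\<^sub>2| = |\<down>a| < |\<down>a'|\<close>.
  The statement for \<open>C - X\<close> follows by reversing the path.
\<close>

text \<open>Applied to the classes along a path: a rainbow triple with constant middle is a special path.\<close>

definition rainbow_triple :: "(nat \<Rightarrow> 'c) \<Rightarrow> nat \<Rightarrow> nat \<Rightarrow> nat \<Rightarrow> bool" where
  "rainbow_triple f i p j \<longleftrightarrow> i < p \<and> p < j \<and> f p \<noteq> f i \<and> f p \<noteq> f j \<and> f i \<noteq> f j"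

lemma rainbow_triple_constant_middle:
  assumes "rainbow_triple f i p j"
  shows "\<exists>i' q j'. i \<le> i' \<and> j' \<le> j \<and> rainbow_triple f i' q j' \<and> (\<forall>k. i' < k \<and> k < j' \<longrightarrow> f k = f q)"
  using assms
proof (induction "j - i" arbitrary: i p j rule: less_induct)
  case less
  have shrink: "\<exists>i' q j'. i \<le> i' \<and> j' \<le> j \<and> rainbow_triple f i' q j' \<and> (\<forall>k. i' < k \<and> k < j' \<longrightarrow> f k = f q)"
    if "rainbow_triple f i0 p0 j0" "i \<le> i0" "j0 \<le> j" "j0 - i0 < j - i" for i0 p0 j0
    using less.hyps[OF that(4,1)] that(2,3) by (meson order.trans)
  show ?case
  proof (cases "\<forall>k. i < k \<and> k < j \<longrightarrow> f k = f p")
    case True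
    with less.prems show ?thesis by blast
  next
    case False
    then obtain k where k: "i < k" "k < j" "f k \<noteq> f p"
      by blast
    then consider "k < p" "f k = f i" | "k < p" "f k \<noteq> f i" | "p < k" "f k = f j" | "p < k" "f k \<noteq> f j"
      by (metis linorder_neqE_nat)
    then show ?thesis
    proof cases
      case 1
      then show ?thesis using shrink[of k p j] k less.prems unfolding rainbow_triple_def by auto
    next
      case 2
      then show ?thesis using shrink[of i k p] k less.prems unfolding rainbow_triple_def by auto
    next
      case 3
      then show ?thesis using shrink[of i p k] k less.prems unfolding rainbow_triple_def by auto
    next
      case 4
      then show ?thesis using shrink[of p k j] k less.prems unfolding rainbow_triple_def by auto
    qed
  qed
qed

lemma ord_iso_sym:
  assumes "ord_iso D r E s"
  shows "ord_iso E s D r"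
proof -
  obtain f where f: "bij_betw f D E" and hom: "\<forall>x\<in>D. \<forall>y\<in>D. r x y \<longleftrightarrow> s (f x) (f y)"
    using assms unfolding ord_iso_def by blast
  have "\<forall>x\<in>E. \<forall>y\<in>E. s x y \<longleftrightarrow> r (inv_into D f x) (inv_into D f y)"
    using hom f by (simp add: bij_betw_def bij_betw_inv_into_right inv_into_into f_inv_into_f)
  then show ?thesis
    unfolding ord_iso_def using bij_betw_inv_into[OF f] by blast
qed

lemma ord_iso_trans:
  assumes "ord_iso D r E s" "ord_iso E s F t"
  shows "ord_iso D r F t"
proof -
  obtain f where f: "bij_betw f D E" and hf: "\<forall>x\<in>D. \<forall>y\<in>D. r x y \<longleftrightarrow> s (f x) (f y)"
    using assms(1) unfolding ord_iso_def by blast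
  obtain g where g: "bij_betw g E F" and hg: "\<forall>x\<in>E. \<forall>y\<in>E. s x y \<longleftrightarrow> t (g x) (g y)"
    using assms(2) unfolding ord_iso_def by blast
  have "\<forall>x\<in>D. \<forall>y\<in>D. r x y \<longleftrightarrow> t ((g \<circ> f) x) ((g \<circ> f) y)"
    using hf hg bij_betw_apply[OF f] by simp
  then show ?thesis
    unfolding ord_iso_def using bij_betw_trans[OF f g] by blast
qed

definition comparable_pairs :: "'x set \<Rightarrow> ('x \<Rightarrow> 'x \<Rightarrow> bool) \<Rightarrow> nat" where
  "comparable_pairs D r = card {(x, y). x \<in> D \<and> y \<in> D \<and> r x y}"

lemma ord_iso_comparable_pairs:
  assumes "ord_iso D r E s"
  shows "comparable_pairs D r = comparable_pairs E s"
proof -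
  obtain f where f: "bij_betw f D E" and hom: "\<forall>x\<in>D. \<forall>y\<in>D. r x y \<longleftrightarrow> s (f x) (f y)"
    using assms unfolding ord_iso_def by blast
  have "bij_betw (map_prod f f) {(x, y). x \<in> D \<and> y \<in> D \<and> r x y} {(x, y). x \<in> E \<and> y \<in> E \<and> s x y}"
  proof (rule bij_betw_subset)
    show "bij_betw (map_prod f f) (D \<times> D) (E \<times> E)"
      by (rule bij_betw_map_prod[OF f f])
    show "map_prod f f ` {(x, y). x \<in> D \<and> y \<in> D \<and> r x y} = {(x, y). x \<in> E \<and> y \<in> E \<and> s x y}"
      using f hom unfolding bij_betw_def by (auto simp: image_iff)
  qed auto
  then show ?thesis
    unfolding comparable_pairs_def by (rule bij_betw_same_card)
qed

lemma exch_adj_sym: "exch_adj D E \<Longrightarrow> exch_adj E D"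
  unfolding exch_adj_def by simp

lemma card_Diff_le_exch_distance:
  assumes adj: "\<forall>i. Suc i < length ws \<longrightarrow> exch_adj (ws ! i) (ws ! Suc i)"
    and fin: "\<forall>D\<in>set ws. finite D" and "k \<le> j" "j < length ws"
  shows "card (ws ! k - ws ! j) \<le> j - k"
  using assms(3,4)
proof (induction j)
  case (Suc j)
  show ?case
  proof (cases "k = Suc j")
    case False
    then have "k \<le> j" using Suc.prems by simp
    have step: "card (ws ! j - ws ! Suc j) = 1"
      using adj Suc.prems unfolding exch_adj_def by blast
    have "card (ws ! k - ws ! Suc j) \<le> card ((ws ! k - ws ! j) \<union> (ws ! j - ws ! Suc j))"
    proof (rule card_mono)
      show "finite ((ws ! k - ws ! j) \<union> (ws ! j - ws ! Suc j))"
        using fin Suc.prems by simp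
    qed blast
    also have "\<dots> \<le> card (ws ! k - ws ! j) + card (ws ! j - ws ! Suc j)"
      by (rule card_Un_le)
    finally show ?thesis using Suc \<open>k \<le> j\<close> step by simp
  qed simp
qed simp

lemma special_path_rev:
  assumes "special_path Q le n \<Gamma> vs"
  shows "special_path Q le n \<Gamma> (rev vs)"
proof -
  obtain P1 P2 P3 where P: "P1 \<in> \<Gamma>" "P2 \<in> \<Gamma>" "P3 \<in> \<Gamma>" "P1 \<noteq> P2" "P2 \<noteq> P3" "P1 \<noteq> P3"
    "ord_iso (hd vs) le (fst P1) (snd P1)"
    "\<forall>i. 0 < i \<and> i < length vs - 1 \<longrightarrow> ord_iso (vs ! i) le (fst P2) (snd P2)"
    "ord_iso (last vs) le (fst P3) (snd P3)"
    using assms unfolding special_path_def by blast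
  have len: "3 \<le> length vs" and adj: "\<forall>i. Suc i < length vs \<longrightarrow> exch_adj (vs ! i) (vs ! Suc i)"
    using assms unfolding special_path_def by auto
  have "exch_adj (rev vs ! i) (rev vs ! Suc i)" if "Suc i < length vs" for i
    using adj[rule_format, of "length vs - Suc (Suc i)"] that
    by (simp add: rev_nth exch_adj_sym Suc_diff_Suc)
  moreover have "ord_iso (rev vs ! i) le (fst P2) (snd P2)" if "0 < i" "i < length vs - 1" for i
    using P(8)[rule_format, of "length vs - Suc i"] that by (simp add: rev_nth) arith
  moreover have "hd (rev vs) = last vs" "last (rev vs) = hd vs"
    using len by (auto simp: hd_rev last_rev)
  ultimately show ?thesis
    using assms P(1-7,9) unfolding special_path_def
    by (simp only: length_rev distinct_rev set_rev) (intro conjI bexI[of _ P3] bexI[of _ P2] bexI[of _ P1]; simp)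
qed

section \<open>Finite posets and their downsets\<close>

locale finite_poset =
  fixes Q :: "'a set" and le :: "'a \<Rightarrow> 'a \<Rightarrow> bool"
  assumes finite_carrier: "finite Q" and poset: "is_poset Q le"
begin

lemma poset_refl: "x \<in> Q \<Longrightarrow> le x x"
  using poset unfolding is_poset_def by blast

lemma poset_antisym: "x \<in> Q \<Longrightarrow> y \<in> Q \<Longrightarrow> le x y \<Longrightarrow> le y x \<Longrightarrow> x = y"
  using poset unfolding is_poset_def by blast

lemma poset_trans: "x \<in> Q \<Longrightarrow> y \<in> Q \<Longrightarrow> z \<in> Q \<Longrightarrow> le x y \<Longrightarrow> le y z \<Longrightarrow> le x z"
  using poset unfolding is_poset_def by blast

definition below :: "'a \<Rightarrow> 'a set" where
  "below x = {y \<in> Q. le y x}"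

definition height :: "'a \<Rightarrow> nat" where
  "height x = card (below x)"

definition minimal_in :: "'a set \<Rightarrow> 'a \<Rightarrow> bool" where
  "minimal_in S x \<longleftrightarrow> x \<in> S \<and> (\<forall>y\<in>S. le y x \<longrightarrow> y = x)"

definition maximal_in :: "'a set \<Rightarrow> 'a \<Rightarrow> bool" where
  "maximal_in S x \<longleftrightarrow> x \<in> S \<and> (\<forall>y\<in>S. le x y \<longrightarrow> y = x)"

lemma height_strict_mono:
  assumes "x \<in> Q" "y \<in> Q" "le x y" "x \<noteq> y"
  shows "height x < height y"
proof -
  have "below x \<subset> below y"
    using assms poset_trans poset_refl poset_antisym unfolding below_def by blast
  then show ?thesis
    unfolding height_def using finite_carrier by (simp add: below_def psubset_card_mono)
qed

lemma least_height_minimal: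
  assumes "S \<subseteq> Q" "x \<in> S" "\<forall>y\<in>S. height x \<le> height y"
  shows "minimal_in S x"
  using assms height_strict_mono unfolding minimal_in_def by (meson leD subsetD)

lemma greatest_height_maximal:
  assumes "S \<subseteq> Q" "x \<in> S" "\<forall>y\<in>S. height y \<le> height x"
  shows "maximal_in S x"
  using assms height_strict_mono unfolding maximal_in_def by (metis leD subsetD)

lemma ex_minimal_in:
  assumes "S \<subseteq> Q" "S \<noteq> {}"
  obtains x where "minimal_in S x"
proof -
  obtain x where "x \<in> S" "\<forall>y\<in>S. height x \<le> height y"
    using assms ex_has_least_nat[of "\<lambda>x. x \<in> S"] by blast
  then show ?thesis using that least_height_minimal assms by blast
qed

lemma ex_maximal_in:
  assumes "S \<subseteq> Q" "S \<noteq> {}"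
  obtains x where "maximal_in S x"
proof -
  have "height y < Suc (card Q)" for y
    unfolding height_def below_def using finite_carrier by (simp add: card_mono le_imp_less_Suc)
  then obtain x where "x \<in> S" "\<forall>y\<in>S. height y \<le> height x"
    using assms ex_has_greatest_nat[of "\<lambda>x. x \<in> S" _ height] by blast
  then show ?thesis using that greatest_height_maximal assms by blast
qed

lemma downset_subset: "downset Q le D \<Longrightarrow> D \<subseteq> Q"
  unfolding downset_def by blast

lemma downset_finite: "downset Q le D \<Longrightarrow> finite D"
  using downset_subset finite_carrier finite_subset by blast

lemma downset_Un: "downset Q le D \<Longrightarrow> downset Q le E \<Longrightarrow> downset Q le (D \<union> E)"
  unfolding downset_def by blast

lemma downset_Int: "downset Q le D \<Longrightarrow> downset Q le E \<Longrightarrow> downset Q le (D \<inter> E)"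
  unfolding downset_def by blast

lemma downset_below: "x \<in> Q \<Longrightarrow> downset Q le (below x)"
  unfolding downset_def below_def using poset_trans by blast

lemma below_subset_downset: "downset Q le D \<Longrightarrow> x \<in> D \<Longrightarrow> below x \<subseteq> D"
  unfolding downset_def below_def by blast

lemma downset_insert:
  assumes "downset Q le D" "t \<in> Q" "below t \<subseteq> insert t D"
  shows "downset Q le (insert t D)"
  using assms unfolding downset_def below_def by blast

lemma downset_Diff_maximal:
  assumes "downset Q le D" "maximal_in D u"
  shows "downset Q le (D - {u})"
  using assms unfolding downset_def maximal_in_def by blast

lemma below_minimal_subset:
  assumes "downset Q le E" "minimal_in (E - F) t"
  shows "below t \<subseteq> insert t F"
  using assms unfolding downset_def minimal_in_def below_def by blast

lemma maximal_in_Diff_downset: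
  assumes "downset Q le E" "D \<subseteq> Q" "maximal_in (D - E) u"
  shows "maximal_in D u"
  using assms unfolding downset_def maximal_in_def by blast

lemma downset_extend:
  assumes D: "downset Q le D" and E: "downset Q le E" "D \<subseteq> E"
    and k: "card D \<le> k" "k \<le> card E"
  obtains F where "downset Q le F" "D \<subseteq> F" "F \<subseteq> E" "card F = k"
proof -
  have "\<exists>F. downset Q le F \<and> D \<subseteq> F \<and> F \<subseteq> E \<and> card F = card D + i" if "card D + i \<le> card E" for i
    using that
  proof (induction i)
    case 0
    then show ?case using D E by (intro exI[of _ D]) simp
  next
    case (Suc i)
    then obtain F where F: "downset Q le F" "D \<subseteq> F" "F \<subseteq> E" "card F = card D + i"
      by fastforce
    have "E - F \<noteq> {}"
    proof
      assume "E - F = {}"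
      then have "E = F" using F(3) by blast
      then show False using Suc.prems F(4) by simp
    qed
    then obtain t where t: "minimal_in (E - F) t"
      using ex_minimal_in[of "E - F"] downset_subset[OF E(1)] by blast
    then have t_in: "t \<in> Q" "t \<in> E - F"
      using downset_subset[OF E(1)] unfolding minimal_in_def by auto
    then have "downset Q le (insert t F)"
      using downset_insert[OF F(1)] below_minimal_subset[OF E(1) t] by blast
    moreover have "card (insert t F) = card D + Suc i"
      using F(4) downset_finite[OF F(1)] t_in by simp
    moreover have "D \<subseteq> insert t F" "insert t F \<subseteq> E"
      using F t_in by auto
    ultimately show ?case by blast
  qed
  from this[of "k - card D"] obtain F where "downset Q le F" "D \<subseteq> F" "F \<subseteq> E" "card F = k"
    using k by auto
  then show thesis by (rule that)
qed

lemma downset_exchange: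
  assumes D: "downset Q le D" and E: "downset Q le E" and card: "card D = card E" and "D \<noteq> E"
  obtains u t where "u \<in> D - E" "t \<in> E - D" "maximal_in D u" "below t \<subseteq> insert t (D - {u})"
proof -
  have "D - E \<noteq> {}"
    using card_subset_eq[OF downset_finite[OF E] _ card] \<open>D \<noteq> E\<close> by blast
  then obtain u where u: "maximal_in (D - E) u"
    using ex_maximal_in[of "D - E"] downset_subset[OF D] by blast
  have "E - D \<noteq> {}"
    using card_subset_eq[OF downset_finite[OF D] _ card[symmetric]] \<open>D \<noteq> E\<close> by blast
  then obtain t where t: "minimal_in (E - D) t"
    using ex_minimal_in[of "E - D"] downset_subset[OF E] by blast
  have "u \<in> D - E" "t \<in> E - D"
    using u t unfolding minimal_in_def maximal_in_def by auto
  moreover have "maximal_in D u"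
    using maximal_in_Diff_downset[OF E downset_subset[OF D] u] .
  moreover have "below t \<subseteq> insert t (D - {u})"
    using below_minimal_subset[OF E t] below_subset_downset[OF E \<open>t \<in> E - D\<close>[THEN DiffD1]]
      \<open>u \<in> D - E\<close> by blast
  ultimately show thesis
    using that by blast
qed

lemma exch_adj_downsetE:
  assumes D: "downset Q le D" and E: "downset Q le E" and "exch_adj D E"
  obtains x y where "D - E = {x}" "E - D = {y}" "maximal_in D x"
proof -
  obtain x y where xy: "D - E = {x}" "E - D = {y}"
    using \<open>exch_adj D E\<close> unfolding exch_adj_def by (meson card_1_singletonE)
  have "maximal_in D x"
    using maximal_in_Diff_downset[OF E downset_subset[OF D]] xy unfolding maximal_in_def by auto
  then show thesis
    using that xy by blast
qed

lemma comparable_pairs_Diff_maximal: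
  assumes D: "downset Q le D" and z: "maximal_in D z"
  shows "comparable_pairs D le = comparable_pairs (D - {z}) le + height z"
proof -
  let ?pairs = "\<lambda>D. {(x, y). x \<in> D \<and> y \<in> D \<and> le x y}"
  let ?top = "(\<lambda>x. (x, z)) ` below z"
  have split: "?pairs D = ?pairs (D - {z}) \<union> ?top"
  proof
    show "?pairs D \<subseteq> ?pairs (D - {z}) \<union> ?top"
      using z downset_subset[OF D] unfolding maximal_in_def below_def by blast
    show "?pairs (D - {z}) \<union> ?top \<subseteq> ?pairs D"
      using z below_subset_downset[OF D, of z] unfolding maximal_in_def below_def by blast
  qed
  have "finite (?pairs (D - {z}))"
    using downset_finite[OF D] by (auto intro: finite_subset[of _ "D \<times> D"])
  moreover have "finite ?top"
    using finite_carrier unfolding below_def by simp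
  moreover have "?pairs (D - {z}) \<inter> ?top = {}"
    by blast
  moreover have "card ?top = height z"
    unfolding height_def by (simp add: card_image inj_on_def)
  ultimately show ?thesis
    unfolding comparable_pairs_def split by (simp add: card_Un_disjoint)
qed

lemma exchange_height_eq:
  assumes D: "downset Q le D" and u: "maximal_in D u" and t: "t \<in> Q" "t \<notin> D"
    and below_t: "below t \<subseteq> insert t (D - {u})"
    and iso: "comparable_pairs D le = comparable_pairs (insert t (D - {u})) le"
  shows "height u = height t"
proof -
  have D': "downset Q le (insert t (D - {u}))"
    by (rule downset_insert[OF downset_Diff_maximal[OF D u] t(1) below_t])
  have "maximal_in (insert t (D - {u})) t"
    unfolding maximal_in_def
  proof (intro conjI ballI impI)
    fix y assume "y \<in> insert t (D - {u})" "le t y"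
    then show "y = t" using t D unfolding downset_def by blast
  qed simp
  moreover have "insert t (D - {u}) - {t} = D - {u}"
    using t by blast
  ultimately have "comparable_pairs (insert t (D - {u})) le = comparable_pairs (D - {u}) le + height t"
    using comparable_pairs_Diff_maximal[OF D'] by metis
  then show ?thesis
    using comparable_pairs_Diff_maximal[OF D u] iso by simp
qed

lemma ex_two_least_height:
  assumes "S \<subseteq> Q" "2 \<le> card S"
  obtains t1 t2 where "minimal_in S t1" "minimal_in (S - {t1}) t2" "height t1 \<le> height t2"
proof -
  obtain t1 where t1: "t1 \<in> S" "\<forall>y\<in>S. height t1 \<le> height y"
    using assms ex_has_least_nat[of "\<lambda>x. x \<in> S" _ height] by fastforce
  have "S - {t1} \<noteq> {}"
  proof
    assume "S - {t1} = {}"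
    then have "card S \<le> card {t1}"
      using card_mono[of "{t1}" S] by blast
    then show False
      using assms(2) by simp
  qed
  then obtain t2 where t2: "t2 \<in> S - {t1}" "\<forall>y\<in>S - {t1}. height t2 \<le> height y"
    using ex_has_least_nat[of "\<lambda>x. x \<in> S - {t1}" _ height] by fastforce
  show thesis
    using that least_height_minimal assms(1) t1 t2 by (metis Diff_subset DiffD1 subset_trans)
qed

lemma covering_exchange_maximal:
  assumes K: "downset Q le K" and "a \<notin> K" "a' \<notin> K"
    and cover: "covers Q le a' a" and "\<not> le a z" "z \<in> Q"
    and D: "D \<subseteq> Q" "a \<in> D" "a' \<in> D" "\<forall>y\<in>D - K. le y a' \<or> le y z" and "t \<in> K"
  shows "maximal_in D a'" "maximal_in (insert t (D - {a'})) a"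
proof -
  have "a \<in> Q" "a' \<in> Q" "le a a'" "a \<noteq> a'" and no_middle: "\<forall>y\<in>Q. le a y \<and> le y a' \<longrightarrow> y = a \<or> y = a'"
    using cover unfolding covers_def by auto
  have not_below_z: "\<not> le y z" if "y \<in> Q" "le a y" for y
    using that \<open>\<not> le a z\<close> \<open>a \<in> Q\<close> \<open>z \<in> Q\<close> poset_trans by blast
  have outside_K: "y \<notin> K" if "y \<in> Q" "le x y" "x \<notin> K" "x \<in> Q" for x y
    using K that unfolding downset_def by blast
  show "maximal_in D a'"
    unfolding maximal_in_def
  proof (intro conjI ballI impI)
    fix y assume y: "y \<in> D" "le a' y"
    then have "y \<in> Q" "y \<notin> K"
      using D(1) outside_K \<open>a' \<notin> K\<close> \<open>a' \<in> Q\<close> by auto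
    have "le a y"
      using poset_trans[OF \<open>a \<in> Q\<close> \<open>a' \<in> Q\<close> \<open>y \<in> Q\<close> \<open>le a a'\<close> y(2)] .
    then have "le y a'"
      using D(4) y(1) \<open>y \<notin> K\<close> not_below_z[OF \<open>y \<in> Q\<close>] by blast
    then show "y = a'"
      using poset_antisym \<open>y \<in> Q\<close> \<open>a' \<in> Q\<close> y(2) by blast
  qed (rule D(3))
  show "maximal_in (insert t (D - {a'})) a"
    unfolding maximal_in_def
  proof (intro conjI ballI impI)
    fix y assume y: "y \<in> insert t (D - {a'})" "le a y"
    have "y \<noteq> t"
      using K \<open>t \<in> K\<close> y(2) \<open>a \<in> Q\<close> \<open>a \<notin> K\<close> unfolding downset_def by blast
    then have "y \<in> D - {a'}"
      using y(1) by blast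
    then have "y \<in> Q"
      using D(1) by blast
    then have "y \<notin> K"
      using outside_K y(2) \<open>a \<notin> K\<close> \<open>a \<in> Q\<close> by blast
    then have "le y a'"
      using D(4) \<open>y \<in> D - {a'}\<close> not_below_z[OF \<open>y \<in> Q\<close> y(2)] by blast
    then show "y = a"
      using no_middle \<open>y \<in> Q\<close> y(2) \<open>y \<in> D - {a'}\<close> by blast
  qed (use D(2) \<open>a \<noteq> a'\<close> in blast)
qed

lemma minimal_in_avoiding:
  assumes D: "downset Q le D" and S: "S \<subseteq> Q" and x: "\<forall>y\<in>S. le x y \<longrightarrow> y = x"
    and ne: "D \<inter> S - {x} \<noteq> {}"
  obtains s where "s \<in> D" "s \<noteq> x" "minimal_in S s"
proof -
  obtain s where s: "minimal_in (D \<inter> S - {x}) s"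
    using ex_minimal_in[of "D \<inter> S - {x}"] ne S by blast
  have "minimal_in S s"
    unfolding minimal_in_def
  proof (intro conjI ballI impI)
    show "s \<in> S"
      using s unfolding minimal_in_def by blast
    fix y assume "y \<in> S" "le y s"
    moreover have "y \<in> D"
      using D s \<open>y \<in> S\<close> \<open>le y s\<close> S unfolding minimal_in_def downset_def by blast
    moreover have "y \<noteq> x"
      using x s \<open>le y s\<close> unfolding minimal_in_def by blast
    ultimately show "y = s"
      using s unfolding minimal_in_def by blast
  qed
  then show thesis
    using that s unfolding minimal_in_def by blast
qed

lemma bad_partition_witnesses:
  assumes "bad_partition Q le S" "S \<subseteq> Q"
  obtains a a' z w where "a \<in> S" "a' \<in> S" "z \<in> S" "w \<in> S" "covers Q le a' a"
    "z \<noteq> a'" "\<not> le a z" "\<not> le w a'" "\<not> le w z"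
proof -
  obtain a' a A1 A2 where part: "a' \<notin> A1" "a' \<notin> A2" "a \<notin> A1" "a \<notin> A2" "A1 \<inter> A2 = {}"
    "S = {a', a} \<union> A1 \<union> A2" "covers Q le a' a"
    and A1: "\<forall>x\<in>A1. le a' x \<or> incomparable le x a'" "A1 \<noteq> {}"
    and A2: "\<forall>x\<in>A2. le x a \<or> incomparable le x a" "A2 \<noteq> {}"
    using assms(1) unfolding bad_partition_def by blast
  obtain x1 x2 where x: "x1 \<in> A1" "x2 \<in> A2"
    using A1(2) A2(2) by blast
  have in_Q: "a \<in> Q" "a' \<in> Q" "x1 \<in> Q" "x2 \<in> Q"
    using part(6) x assms(2) by auto
  have "\<not> le x1 a'" "\<not> le a x2"
    using A1(1) A2(1) x part poset_antisym in_Q unfolding incomparable_def by metis+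
  show thesis
  proof (cases "le x1 x2")
    case True
    then have "\<not> le a x1" "\<not> le x2 a'" "\<not> le x2 x1"
      using \<open>\<not> le x1 a'\<close> \<open>\<not> le a x2\<close> poset_trans poset_antisym in_Q part(5) x by blast+
    then show thesis
      using that[of a a' x1 x2] part(1,6,7) x by blast
  next
    case False
    then show thesis
      using that[of a a' x2 x1] \<open>\<not> le x1 a'\<close> \<open>\<not> le a x2\<close> part(2,6,7) x by blast
  qed
qed

end

section \<open>Minimal special paths\<close>

locale minimal_special_path = finite_poset Q le
  for Q :: "'a set" and le :: "'a \<Rightarrow> 'a \<Rightarrow> bool" +
  fixes n :: nat and \<Gamma> :: "('b set \<times> ('b \<Rightarrow> 'b \<Rightarrow> bool)) set" and vs :: "'a set list"
  assumes noniso: "\<forall>P\<in>\<Gamma>. \<forall>P'\<in>\<Gamma>. P \<noteq> P' \<longrightarrow> \<not> ord_iso (fst P) (snd P) (fst P') (snd P')"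
    and witness: "is_witness Q le n \<Gamma>"
    and special: "special_path Q le n \<Gamma> vs"
    and minimal: "\<forall>ws. special_path Q le n \<Gamma> ws \<longrightarrow> length vs \<le> length ws"
begin

abbreviation V :: "'a set set" where
  "V \<equiv> exch_vertices Q le n"

lemma vertex_downset: "D \<in> V \<Longrightarrow> downset Q le D"
  unfolding exch_vertices_def by simp

lemma vertex_card: "D \<in> V \<Longrightarrow> card D = n"
  unfolding exch_vertices_def by simp

lemma vertexI: "downset Q le D \<Longrightarrow> card D = n \<Longrightarrow> D \<in> V"
  unfolding exch_vertices_def by simp

text \<open>Only meaningful on \<open>V\<close>, where the witness property makes the class exist and
  non-isomorphism of \<open>\<Gamma>\<close> makes it unique.\<close>

definition iso_class :: "'a set \<Rightarrow> 'b set \<times> ('b \<Rightarrow> 'b \<Rightarrow> bool)" where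
  "iso_class D = (SOME P. P \<in> \<Gamma> \<and> ord_iso D le (fst P) (snd P))"

lemma iso_class: "D \<in> V \<Longrightarrow> iso_class D \<in> \<Gamma> \<and> ord_iso D le (fst (iso_class D)) (snd (iso_class D))"
  using witness unfolding is_witness_def iso_class_def by (metis (mono_tags, lifting) someI_ex)

lemma iso_class_eqI:
  assumes "D \<in> V" "P \<in> \<Gamma>" "ord_iso D le (fst P) (snd P)"
  shows "iso_class D = P"
  using noniso iso_class[OF assms(1)] assms(2,3) ord_iso_sym ord_iso_trans by metis

lemma iso_class_comparable_pairs:
  "D \<in> V \<Longrightarrow> E \<in> V \<Longrightarrow> iso_class D = iso_class E \<Longrightarrow> comparable_pairs D le = comparable_pairs E le"
  using iso_class ord_iso_comparable_pairs by metis

definition r :: nat where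
  "r = length vs - 1"

definition A :: "'a set" where
  "A = hd vs"

definition C :: "'a set" where
  "C = last vs"

definition X :: "'a set" where
  "X = A \<inter> C"

definition m :: nat where
  "m = card (A - C)"

text \<open>The classes \<open>A, B, C\<close> of the paper: first, interior and last vertex of the path.\<close>

definition \<alpha> :: "'b set \<times> ('b \<Rightarrow> 'b \<Rightarrow> bool)" where
  "\<alpha> = iso_class A"

definition \<beta> :: "'b set \<times> ('b \<Rightarrow> 'b \<Rightarrow> bool)" where
  "\<beta> = iso_class (vs ! 1)"

definition \<gamma> :: "'b set \<times> ('b \<Rightarrow> 'b \<Rightarrow> bool)" where
  "\<gamma> = iso_class C"

lemma length_vs: "length vs = Suc r" and r_ge_2: "2 \<le> r"
  using special unfolding special_path_def r_def by auto

lemma vs_vertex: "i \<le> r \<Longrightarrow> vs ! i \<in> V"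
  using special length_vs unfolding special_path_def by (simp add: subset_iff)

lemma vs_adj: "i < r \<Longrightarrow> exch_adj (vs ! i) (vs ! Suc i)"
  using special length_vs unfolding special_path_def by simp

lemma A_nth: "A = vs ! 0"
  using length_vs unfolding A_def by (metis hd_conv_nth list.size(3) nat.distinct(1))

lemma C_nth: "C = vs ! r"
  using length_vs unfolding C_def by (metis diff_Suc_1 last_conv_nth list.size(3) nat.distinct(1))

lemma A_vertex: "A \<in> V" and C_vertex: "C \<in> V"
  using vs_vertex A_nth C_nth by auto

lemma path_classes: "\<alpha> \<noteq> \<beta>" "\<beta> \<noteq> \<gamma>" "\<alpha> \<noteq> \<gamma>" "0 < i \<Longrightarrow> i < r \<Longrightarrow> iso_class (vs ! i) = \<beta>"
proof -
  obtain P1 P2 P3 where P: "P1 \<in> \<Gamma>" "P2 \<in> \<Gamma>" "P3 \<in> \<Gamma>" "P1 \<noteq> P2" "P2 \<noteq> P3" "P1 \<noteq> P3"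
    "ord_iso A le (fst P1) (snd P1)" "\<forall>i. 0 < i \<and> i < r \<longrightarrow> ord_iso (vs ! i) le (fst P2) (snd P2)"
    "ord_iso C le (fst P3) (snd P3)"
    using special unfolding special_path_def A_def C_def r_def by blast
  have mid: "iso_class (vs ! i) = P2" if "0 < i" "i < r" for i
    using vs_vertex[of i] P(8) that by (intro iso_class_eqI[OF _ P(2)]) auto
  have "\<alpha> = P1" "\<gamma> = P3"
    unfolding \<alpha>_def \<gamma>_def by (rule iso_class_eqI[OF A_vertex P(1,7)], rule iso_class_eqI[OF C_vertex P(3,9)])
  moreover have "\<beta> = P2"
    unfolding \<beta>_def using mid[of 1] r_ge_2 by simp
  ultimately show "\<alpha> \<noteq> \<beta>" "\<beta> \<noteq> \<gamma>" "\<alpha> \<noteq> \<gamma>" "0 < i \<Longrightarrow> i < r \<Longrightarrow> iso_class (vs ! i) = \<beta>"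
    using P mid by auto
qed

text \<open>The only use of the minimality of \<open>vs\<close>.\<close>

lemma length_le_special_path:
  assumes len: "3 \<le> length ws" and "distinct ws" "set ws \<subseteq> V"
    and "\<forall>i. Suc i < length ws \<longrightarrow> exch_adj (ws ! i) (ws ! Suc i)"
    and mid: "\<forall>i. 0 < i \<and> i < length ws - 1 \<longrightarrow> iso_class (ws ! i) = iso_class (ws ! 1)"
    and "iso_class (hd ws) \<noteq> iso_class (ws ! 1)" "iso_class (ws ! 1) \<noteq> iso_class (last ws)"
    and "iso_class (hd ws) \<noteq> iso_class (last ws)"
  shows "length vs \<le> length ws"
proof -
  have nth_V: "ws ! i \<in> V" if "i < length ws" for i
    using assms(3) that by auto
  have "ws \<noteq> []"
    using len by auto
  then have ends: "hd ws \<in> V" "last ws \<in> V"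
    using assms(3) by auto
  have mid_iso: "ord_iso (ws ! i) le (fst (iso_class (ws ! 1))) (snd (iso_class (ws ! 1)))"
    if "0 < i" "i < length ws - 1" for i
  proof -
    have "iso_class (ws ! i) = iso_class (ws ! 1)"
      using mid that by blast
    then show ?thesis
      using iso_class[OF nth_V[of i]] that by simp
  qed
  have "\<exists>P1\<in>\<Gamma>. \<exists>P2\<in>\<Gamma>. \<exists>P3\<in>\<Gamma>. P1 \<noteq> P2 \<and> P2 \<noteq> P3 \<and> P1 \<noteq> P3 \<and>
      ord_iso (hd ws) le (fst P1) (snd P1) \<and>
      (\<forall>i. 0 < i \<and> i < length ws - 1 \<longrightarrow> ord_iso (ws ! i) le (fst P2) (snd P2)) \<and>
      ord_iso (last ws) le (fst P3) (snd P3)"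
  proof (rule bexI[OF _ conjunct1[OF iso_class[OF ends(1)]]],
      rule bexI[OF _ conjunct1[OF iso_class[OF nth_V[of 1]]]],
      rule bexI[OF _ conjunct1[OF iso_class[OF ends(2)]]])
    show "1 < length ws"
      using len by simp
  qed (use assms(6-8) mid_iso iso_class[OF ends(1)] iso_class[OF ends(2)] in auto)
  then have "special_path Q le n \<Gamma> ws"
    unfolding special_path_def using assms(1-4) by blast
  then show ?thesis
    using minimal by blast
qed

definition exch_path :: "(nat \<Rightarrow> 'a set) \<Rightarrow> nat \<Rightarrow> bool" where
  "exch_path g l \<longleftrightarrow> (\<forall>k\<le>l. g k \<in> V) \<and> inj_on g {..l} \<and> (\<forall>k<l. exch_adj (g k) (g (Suc k)))"

lemma exch_path_shift:
  assumes "exch_path g l" "i \<le> j" "j \<le> l"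
  shows "exch_path (\<lambda>k. g (i + k)) (j - i)"
proof -
  have "inj_on ((+) i) {..j - i}" "(+) i ` {..j - i} \<subseteq> {..l}"
    using assms(2,3) by auto
  then have "inj_on (g \<circ> (+) i) {..j - i}"
    using assms(1) unfolding exch_path_def by (meson comp_inj_on inj_on_subset)
  then show ?thesis
    using assms unfolding exch_path_def by (simp add: comp_def)
qed

lemma exch_path_Cons:
  assumes path: "exch_path g l" and "x \<in> V" "x \<notin> g ` {..l}" "exch_adj x (g 0)"
  shows "exch_path (case_nat x g) (Suc l)"
  unfolding exch_path_def
proof (intro conjI allI impI)
  show "inj_on (case_nat x g) {..Suc l}"
  proof (rule inj_onI)
    fix a b assume "a \<in> {..Suc l}" "b \<in> {..Suc l}" "case_nat x g a = case_nat x g b"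
    then show "a = b"
      using path assms(3) unfolding exch_path_def inj_on_def by (cases a; cases b) auto
  qed
  fix k
  show "k \<le> Suc l \<Longrightarrow> case_nat x g k \<in> V"
    using path assms(2) unfolding exch_path_def by (cases k) auto
  show "k < Suc l \<Longrightarrow> exch_adj (case_nat x g k) (case_nat x g (Suc k))"
    using path assms(4) unfolding exch_path_def by (cases k) auto
qed

lemma exch_path_length_ge:
  assumes path: "exch_path g l" and "2 \<le> l"
    and mid: "\<forall>k. 0 < k \<and> k < l \<longrightarrow> iso_class (g k) = c"
    and "c \<noteq> iso_class (g 0)" "c \<noteq> iso_class (g l)" "iso_class (g 0) \<noteq> iso_class (g l)"
  shows "r \<le> l"
proof -
  define ws where "ws = map g [0..<Suc l]"
  have len: "length ws = Suc l" and nth: "\<And>k. k < Suc l \<Longrightarrow> ws ! k = g k"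
    unfolding ws_def by (simp_all del: upt_Suc)
  have "length vs \<le> length ws"
  proof (rule length_le_special_path)
    show "3 \<le> length ws"
      using len \<open>2 \<le> l\<close> by simp
    show "distinct ws"
      using path unfolding ws_def exch_path_def
      by (simp add: distinct_map atLeast0LessThan lessThan_Suc_atMost del: upt_Suc)
    show "set ws \<subseteq> V"
      using path unfolding ws_def exch_path_def by (auto simp del: upt_Suc)
    show "\<forall>i. Suc i < length ws \<longrightarrow> exch_adj (ws ! i) (ws ! Suc i)"
      using path len nth unfolding exch_path_def by simp
    have "hd ws = g 0" "last ws = g l" "iso_class (ws ! 1) = c"
      using nth len mid \<open>2 \<le> l\<close> unfolding ws_def by (simp_all add: hd_map last_map del: upt_Suc)
    then show "\<forall>i. 0 < i \<and> i < length ws - 1 \<longrightarrow> iso_class (ws ! i) = iso_class (ws ! 1)"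
      "iso_class (hd ws) \<noteq> iso_class (ws ! 1)" "iso_class (ws ! 1) \<noteq> iso_class (last ws)"
      "iso_class (hd ws) \<noteq> iso_class (last ws)"
      using assms(4-6) mid len nth by auto
  qed
  then show ?thesis
    using len length_vs by simp
qed

lemma exch_path_three_classes:
  assumes path: "exch_path g l" and "l \<le> r" "p \<le> l"
    and p: "iso_class (g p) \<noteq> iso_class (g 0)" "iso_class (g p) \<noteq> iso_class (g l)"
    and ends: "iso_class (g 0) \<noteq> iso_class (g l)"
  shows "l = r" "\<And>k. 0 < k \<Longrightarrow> k < l \<Longrightarrow> iso_class (g k) = iso_class (g p)"
proof -
  let ?f = "\<lambda>k. iso_class (g k)"
  have "0 < p" "p < l"
    using p \<open>p \<le> l\<close> by (auto intro: Nat.gr0I simp: order.order_iff_strict)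
  then have "rainbow_triple ?f 0 p l"
    unfolding rainbow_triple_def using p ends by simp
  then obtain i q j where "j \<le> l" and rainbow: "rainbow_triple ?f i q j"
    and const: "\<forall>k. i < k \<and> k < j \<longrightarrow> ?f k = ?f q"
    using rainbow_triple_constant_middle by blast
  have seg: "i < q" "q < j" "j \<le> l" "?f q \<noteq> ?f i" "?f q \<noteq> ?f j" "?f i \<noteq> ?f j"
    using rainbow \<open>j \<le> l\<close> unfolding rainbow_triple_def by auto
  define c where "c = ?f q"
  have mid: "?f k = c" if "i < k" "k < j" for k
    using const that unfolding c_def by blast
  have c_ne: "c \<noteq> ?f i" "c \<noteq> ?f j"
    using seg unfolding c_def by auto
  have "r \<le> j - i"
  proof (rule exch_path_length_ge)
    show "exch_path (\<lambda>k. g (i + k)) (j - i)"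
      using exch_path_shift[OF path] seg by simp
    show "2 \<le> j - i"
      using seg by simp
    show "\<forall>k. 0 < k \<and> k < j - i \<longrightarrow> iso_class (g (i + k)) = c"
      using mid by (simp add: less_diff_conv add.commute)
    have "i + (j - i) = j"
      using seg by simp
    then show "c \<noteq> iso_class (g (i + 0))" "c \<noteq> iso_class (g (i + (j - i)))"
      "iso_class (g (i + 0)) \<noteq> iso_class (g (i + (j - i)))"
      using seg c_ne by simp_all
  qed
  then show "l = r"
    using seg \<open>l \<le> r\<close> by simp
  have "i = 0" "j = l"
    using seg \<open>l \<le> r\<close> \<open>r \<le> j - i\<close> by auto
  then show "?f k = ?f p" if "0 < k" "k < l" for k
    using mid that \<open>0 < p\<close> \<open>p < l\<close> by simp
qed

section \<open>Vertices between the two ends of the path\<close>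

text \<open>Such a vertex is determined by \<open>D \<inter> A\<close> and \<open>D - A\<close>; \<open>between_le\<close> is the componentwise
  order, along which monotone paths from \<open>A\<close> to \<open>C\<close> run with one level per step.\<close>

definition between :: "'a set \<Rightarrow> bool" where
  "between D \<longleftrightarrow> D \<in> V \<and> X \<subseteq> D \<and> D \<subseteq> A \<union> C"

definition level :: "'a set \<Rightarrow> nat" where
  "level D = card (D - A)"

definition between_le :: "'a set \<Rightarrow> 'a set \<Rightarrow> bool" where
  "between_le D E \<longleftrightarrow> E \<inter> A \<subseteq> D \<inter> A \<and> D - A \<subseteq> E - A"

lemma A_downset: "downset Q le A" and C_downset: "downset Q le C"
  using A_vertex C_vertex vertex_downset by auto

lemma finite_A: "finite A" and finite_C: "finite C"
  using A_downset C_downset downset_finite by auto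

lemma between_A: "between A" and between_C: "between C"
  unfolding between_def X_def using A_vertex C_vertex by auto

lemma between_vertex: "between D \<Longrightarrow> D \<in> V"
  unfolding between_def by simp

lemma card_X: "n = card X + m"
  using card_Int_Diff[OF finite_A, of C] vertex_card[OF A_vertex] unfolding X_def m_def by simp

lemma level_A: "level A = 0"
  unfolding level_def by simp

lemma level_C: "level C = m"
proof -
  have "card (C - A) = card C - card X" "card (A - C) = card A - card X"
    unfolding X_def using finite_A finite_C by (auto simp: card_Diff_subset_Int Int_commute)
  then show ?thesis
    unfolding level_def m_def using vertex_card A_vertex C_vertex by simp
qed

lemma between_card_Int_A: "between D \<Longrightarrow> card (D \<inter> A) + level D = n"
  unfolding level_def using card_Int_Diff vertex_card downset_finite vertex_downset
  by (metis between_vertex)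

lemma between_card_Int_C: "between D \<Longrightarrow> card (D \<inter> C) = card X + level D"
proof -
  assume D: "between D"
  then have "D \<inter> C = X \<union> (D - A)" "X \<inter> (D - A) = {}"
    unfolding between_def X_def by auto
  then show ?thesis
    unfolding level_def using D finite_C finite_A unfolding X_def
    by (simp add: card_Un_disjoint between_def downset_finite vertex_downset)
qed

lemma card_C_Diff_between: "between D \<Longrightarrow> card (C - D) = m - level D"
  using between_card_Int_C[of D] card_Diff_subset_Int[of C D] vertex_card[OF C_vertex]
    card_X finite_C by (simp add: Int_commute)

lemma card_Int_A_Diff_C_between: "between D \<Longrightarrow> card (D \<inter> (A - C)) = m - level D"
proof -
  assume D: "between D"
  then have "D \<inter> A = X \<union> (D \<inter> (A - C))" "X \<inter> (D \<inter> (A - C)) = {}"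
    unfolding between_def X_def by auto
  then have "card (D \<inter> A) = card X + card (D \<inter> (A - C))"
    using finite_A unfolding X_def by (simp add: card_Un_disjoint)
  then show ?thesis
    using between_card_Int_A[OF D] card_X by simp
qed

lemma between_le_A: "between D \<Longrightarrow> between_le A D"
  unfolding between_le_def by auto

lemma between_le_C: "between D \<Longrightarrow> between_le D C"
  unfolding between_le_def between_def X_def by auto

lemma between_le_level: "between E \<Longrightarrow> between_le D E \<Longrightarrow> level D \<le> level E"
  unfolding between_le_def level_def
  by (meson between_vertex card_mono finite_Diff vertex_downset downset_finite)

lemma between_exchange:
  assumes D: "between D" and u: "maximal_in D u" "u \<notin> C"
    and t: "t \<in> C" "t \<notin> D" and below_t: "below t \<subseteq> insert t (D - {u})"
  defines "D' \<equiv> insert t (D - {u})"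
  shows "between D'" "level D' = Suc (level D)" "exch_adj D D'" "between_le D D'"
proof -
  have downset: "downset Q le D"
    using D between_vertex vertex_downset by blast
  have "u \<in> D" "u \<in> A" "t \<notin> A"
    using D u t unfolding maximal_in_def between_def X_def by auto
  have "t \<in> Q"
    using t(1) downset_subset[OF C_downset] by blast
  then have "downset Q le D'"
    unfolding D'_def by (rule downset_insert[OF downset_Diff_maximal[OF downset u(1)] _ below_t])
  moreover have "card D' = card D"
    unfolding D'_def using \<open>u \<in> D\<close> t downset_finite[OF downset]
    by (simp add: card_Suc_Diff1 del: card_Diff_insert)
  then have "card D' = n"
    using vertex_card between_vertex[OF D] by simp
  ultimately have "D' \<in> V"
    by (rule vertexI)
  then show "between D'"
    using D u t unfolding between_def D'_def X_def by auto
  have "D' - A = insert t (D - A)"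
    unfolding D'_def using \<open>u \<in> A\<close> \<open>t \<notin> A\<close> by blast
  then show "level D' = Suc (level D)"
    unfolding level_def using t downset_finite[OF downset] by simp
  have "D - D' = {u}" "D' - D = {t}"
    unfolding D'_def using \<open>u \<in> D\<close> t by auto
  then show "exch_adj D D'"
    unfolding exch_adj_def by simp
  show "between_le D D'"
    unfolding between_le_def D'_def using \<open>u \<in> A\<close> \<open>t \<notin> A\<close> by blast
qed

lemma between_step:
  assumes D: "between D" and E: "between E" and DE: "between_le D E" "D \<noteq> E"
  obtains D' where "between D'" "level D' = Suc (level D)" "exch_adj D D'" "between_le D' E"
proof -
  have downsets: "downset Q le D" "downset Q le E"
    using D E between_vertex vertex_downset by auto
  obtain u t where ut: "u \<in> D - E" "t \<in> E - D" "maximal_in D u" "below t \<subseteq> insert t (D - {u})"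
    using downset_exchange[OF downsets] vertex_card between_vertex D E DE(2) by metis
  have "u \<notin> C" "t \<in> C"
    using ut D E DE(1) unfolding between_def between_le_def X_def by blast+
  then have "between_le (insert t (D - {u})) E"
    using ut DE(1) unfolding between_le_def by blast
  then show thesis
    using that between_exchange[OF D ut(3) \<open>u \<notin> C\<close> \<open>t \<in> C\<close> _ ut(4)] ut(2) by blast
qed

definition mono_path :: "(nat \<Rightarrow> 'a set) \<Rightarrow> nat \<Rightarrow> nat \<Rightarrow> bool" where
  "mono_path g i j \<longleftrightarrow>
     (\<forall>k\<in>{i..j}. between (g k) \<and> level (g k) = k) \<and> (\<forall>k\<in>{i..<j}. exch_adj (g k) (g (Suc k)))"

lemma mono_path_exists:
  assumes "between D" "between E" "between_le D E"
  shows "\<exists>g. mono_path g (level D) (level E) \<and> g (level D) = D \<and> g (level E) = E"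
  using assms
proof (induction "level E - level D" arbitrary: D rule: less_induct)
  case less
  show ?case
  proof (cases "D = E")
    case True
    then show ?thesis
      using less.prems unfolding mono_path_def by (intro exI[of _ "\<lambda>_. D"]) auto
  next
    case False
    then obtain D' where D': "between D'" "level D' = Suc (level D)" "exch_adj D D'" "between_le D' E"
      using between_step less.prems by blast
    moreover have "level D' \<le> level E"
      using between_le_level less.prems(2) D'(4) by blast
    moreover have "level E - level D' < level E - level D"
      using D'(2) \<open>level D' \<le> level E\<close> by simp
    ultimately obtain g where g: "mono_path g (level D') (level E)" "g (level D') = D'" "g (level E) = E"
      using less.hyps[of D'] less.prems(2) by blast
    let ?g = "g(level D := D)"
    have "between (?g k) \<and> level (?g k) = k" if "k \<in> {level D..level E}" for k
      using g(1) less.prems(1) that D'(2) unfolding mono_path_def by (cases "k = level D") auto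
    moreover have "exch_adj (?g k) (?g (Suc k))" if "k \<in> {level D..<level E}" for k
      using g(1,2) D'(2,3) that unfolding mono_path_def by (cases "k = level D") auto
    ultimately have "mono_path ?g (level D) (level E)"
      unfolding mono_path_def by blast
    moreover have "level D \<noteq> level E"
      using D'(2) \<open>level D' \<le> level E\<close> by simp
    ultimately show ?thesis
      using g(3) by (intro exI[of _ ?g]) simp
  qed
qed

lemma mono_path_append:
  assumes g: "mono_path g i j" and h: "mono_path h j k" and "g j = h j"
  shows "mono_path (\<lambda>t. if t \<le> j then g t else h t) i k"
proof -
  let ?gh = "\<lambda>t. if t \<le> j then g t else h t"
  have "between (?gh t) \<and> level (?gh t) = t" if "t \<in> {i..k}" for t
    using g h that unfolding mono_path_def by (cases "t \<le> j") auto
  moreover have "exch_adj (?gh t) (?gh (Suc t))" if t: "t \<in> {i..<k}" for t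
  proof -
    consider "t < j" | "t = j" | "j < t" by fastforce
    then show ?thesis
    proof cases
      case 1
      then show ?thesis using g t unfolding mono_path_def by auto
    next
      case 2
      then show ?thesis using h t \<open>g j = h j\<close> unfolding mono_path_def by auto
    next
      case 3
      then show ?thesis using h t unfolding mono_path_def by auto
    qed
  qed
  ultimately show ?thesis
    unfolding mono_path_def by blast
qed

lemma mono_path_exch_path:
  assumes "mono_path g 0 l"
  shows "exch_path g l"
proof -
  have "inj_on g {..l}"
  proof (rule inj_onI)
    fix a b assume "a \<in> {..l}" "b \<in> {..l}" "g a = g b"
    then show "a = b"
      using assms unfolding mono_path_def by (metis atLeastAtMost_iff atMost_iff le0)
  qed
  then show ?thesis
    using assms between_vertex unfolding mono_path_def exch_path_def by auto
qed

lemma mono_path_through: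
  assumes D: "between D" and E: "between E" and DE: "between_le D E"
  obtains g where "mono_path g 0 m" "g 0 = A" "g m = C" "g (level D) = D" "g (level E) = E"
proof -
  have levels: "level D \<le> level E" "level E \<le> m"
    using between_le_level[OF E DE] between_le_level[OF between_C between_le_C[OF E]] level_C
    by simp_all
  obtain g1 where g1: "mono_path g1 0 (level D)" "g1 0 = A" "g1 (level D) = D"
    using mono_path_exists[OF between_A D between_le_A[OF D]] unfolding level_A by blast
  obtain g2 where g2: "mono_path g2 (level D) (level E)" "g2 (level D) = D" "g2 (level E) = E"
    using mono_path_exists[OF D E DE] by blast
  obtain g3 where g3: "mono_path g3 (level E) m" "g3 (level E) = E" "g3 m = C"
    using mono_path_exists[OF E between_C between_le_C[OF E]] unfolding level_C by blast
  have "D = E" if "level D = level E"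
    using g2(2,3) that by metis
  define g12 where "g12 = (\<lambda>t. if t \<le> level D then g1 t else g2 t)"
  have g12: "mono_path g12 0 (level E)"
    unfolding g12_def by (rule mono_path_append[OF g1(1) g2(1)]) (simp only: g1(3) g2(2))
  have g12_E: "g12 (level E) = E"
    unfolding g12_def using g1(3) g2(3) levels(1) \<open>level D = level E \<Longrightarrow> D = E\<close> by simp
  define g where "g = (\<lambda>t. if t \<le> level E then g12 t else g3 t)"
  have "mono_path g 0 m"
    unfolding g_def by (rule mono_path_append[OF g12 g3(1)]) (simp only: g12_E g3(2))
  moreover have "g m = C"
    unfolding g_def using g12_E g3(2,3) levels(2) by (cases "m = level E") simp_all
  moreover have "g 0 = A" "g (level D) = D"
    unfolding g_def g12_def using g1(2,3) levels(1) by simp_all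
  moreover have "g (level E) = E"
    unfolding g_def using g12_E by simp
  ultimately show thesis
    using that by blast
qed

lemma finite_vs: "\<forall>D\<in>set vs. finite D"
  using vs_vertex length_vs vertex_downset downset_finite by (auto simp: in_set_conv_nth less_Suc_eq_le)

lemma m_le_r: "m \<le> r"
  using card_Diff_le_exch_distance[OF _ finite_vs, of 0 r] vs_adj length_vs A_nth C_nth
  unfolding m_def by simp

lemma between_le_class_eq:
  assumes D: "between D" and E: "between E" and DE: "between_le D E"
    and "0 < level D" "level E < m" and beta: "iso_class D = \<beta> \<or> iso_class E = \<beta>"
  shows "iso_class D = iso_class E"
proof -
  obtain g where g: "mono_path g 0 m" "g 0 = A" "g m = C" "g (level D) = D" "g (level E) = E"
    using mono_path_through[OF D E DE] by blast
  have path: "exch_path g m"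
    using mono_path_exch_path[OF g(1)] .
  have ends: "iso_class (g 0) = \<alpha>" "iso_class (g m) = \<gamma>"
    using g unfolding \<alpha>_def \<gamma>_def by auto
  have "level D \<le> level E"
    using between_le_level[OF E DE] .
  obtain p where p: "p \<le> m" "iso_class (g p) = \<beta>"
    using beta g \<open>level D \<le> level E\<close> \<open>level E < m\<close> by (metis less_imp_le order.trans)
  have interior_beta: "iso_class (g k) = \<beta>" if "0 < k" "k < m" for k
    using exch_path_three_classes(2)[OF path m_le_r p(1) _ _ _ that] ends path_classes p(2) by simp
  have "iso_class D = \<beta>" "iso_class E = \<beta>"
    using interior_beta[of "level D"] interior_beta[of "level E"] g(4,5) assms(4,5)
      \<open>level D \<le> level E\<close> by simp_all
  then show ?thesis
    by simp
qed

lemma three_class_triple: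
  assumes "x \<in> V" "y \<in> V" "z \<in> V" "exch_adj x y" "exch_adj y z"
    and "iso_class x \<noteq> iso_class y" "iso_class y \<noteq> iso_class z" "iso_class x \<noteq> iso_class z"
  shows "r \<le> 2"
proof -
  have "length vs \<le> length [x, y, z]"
    by (rule length_le_special_path) (use assms in \<open>auto simp: less_Suc_eq nth_Cons'\<close>)
  then show ?thesis
    using length_vs by simp
qed

lemma first_step_adj: "exch_adj A (vs ! 1)"
  using vs_adj[of 0] r_ge_2 A_nth by simp

lemma card_Diff_C_not_between:
  assumes "\<not> between (vs ! 1)"
  shows "m \<le> card (vs ! 1 - C)"
proof -
  let ?v = "vs ! 1"
  have v: "?v \<in> V"
    using vs_vertex r_ge_2 by simp
  obtain x y where xy: "A - ?v = {x}" "?v - A = {y}" "maximal_in A x"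
    by (rule exch_adj_downsetE[OF A_downset vertex_downset[OF v] first_step_adj])
  have fin: "finite (?v - C)"
    using downset_finite[OF vertex_downset[OF v]] by simp
  have v_eq: "?v = insert y (A - {x})" and "x \<in> A" "y \<notin> A"
    using xy by blast+
  have "\<not> X \<subseteq> ?v \<or> \<not> ?v \<subseteq> A \<union> C"
    using assms v unfolding between_def by blast
  then consider "x \<in> C" | "y \<notin> C"
    unfolding v_eq X_def using \<open>x \<in> A\<close> by blast
  then show ?thesis
  proof cases
    case 1
    then have "A - C \<subseteq> ?v - C"
      unfolding v_eq by blast
    then show ?thesis
      unfolding m_def using card_mono fin by blast
  next
    case 2
    then have sub: "insert y (A - C - {x}) \<subseteq> ?v - C" and "y \<notin> A - C - {x}"
      unfolding v_eq using \<open>y \<notin> A\<close> by blast+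
    have "card (insert y (A - C - {x})) = Suc (card (A - C - {x}))"
      using finite_A \<open>y \<notin> A - C - {x}\<close> by simp
    then have "Suc (card (A - C - {x})) \<le> card (?v - C)"
      using card_mono[OF fin sub] by simp
    moreover have "card (A - C) \<le> Suc (card (A - C - {x}))"
      by (cases "x \<in> A - C") (simp_all add: card_Diff_singleton)
    ultimately show ?thesis
      unfolding m_def by linarith
  qed
qed

text \<open>Otherwise \<open>v\<^sub>1\<close> followed by a monotone path from \<open>A\<close> to \<open>C\<close> is a path of length
  \<open>m + 1 \<le> r\<close> whose interior is forced to have class \<open>\<alpha>\<close>; its last interior vertex, \<open>C\<close> and
  \<open>v\<^bsub>r-1\<^esub>\<close> then form a special path of length 2.\<close>

lemma first_step_between:
  assumes "2 \<le> m"
  shows "between (vs ! 1)"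
proof (rule ccontr)
  let ?v = "vs ! 1"
  assume not_between: "\<not> between ?v"
  have "card (?v - C) \<le> r - 1"
    using card_Diff_le_exch_distance[OF _ finite_vs, of 1 r] vs_adj length_vs r_ge_2 C_nth by simp
  then have "Suc m \<le> r"
    using card_Diff_C_not_between[OF not_between] r_ge_2 by simp
  obtain g where g: "mono_path g 0 m" "g 0 = A" "g m = C"
    using mono_path_exists[OF between_A between_C between_le_C[OF between_A]]
    unfolding level_A level_C by blast
  have v: "?v \<in> V"
    using vs_vertex r_ge_2 by simp
  have "?v \<notin> g ` {..m}"
    using g(1) not_between unfolding mono_path_def by (auto simp: atLeast0AtMost)
  then have path: "exch_path (case_nat ?v g) (Suc m)"
    using exch_adj_sym[OF first_step_adj] g(2)
    by (intro exch_path_Cons[OF mono_path_exch_path[OF g(1)] v]) simp_all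
  have "iso_class (case_nat ?v g m) = iso_class (case_nat ?v g 1)"
    using exch_path_three_classes(2)[OF path \<open>Suc m \<le> r\<close>, of 1 m] g(2,3) path_classes assms
    unfolding \<alpha>_def \<beta>_def \<gamma>_def by simp
  moreover have "case_nat ?v g m = g (m - 1)"
    using assms by (cases m) simp_all
  ultimately have "iso_class (g (m - 1)) = \<alpha>"
    using g(2) unfolding \<alpha>_def by simp
  moreover have "exch_adj (g (m - 1)) C" "g (m - 1) \<in> V"
    using g assms unfolding mono_path_def by (auto intro: between_vertex dest: bspec[of _ _ "m - 1"])
  moreover have "exch_adj C (vs ! (r - 1))" "iso_class (vs ! (r - 1)) = \<beta>"
    using vs_adj[of "r - 1"] path_classes(4)[of "r - 1"] r_ge_2 C_nth exch_adj_sym by simp_all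
  ultimately have "r \<le> 2"
    using three_class_triple[OF _ C_vertex vs_vertex[of "r - 1"]] path_classes unfolding \<gamma>_def
    by simp
  then show False
    using \<open>Suc m \<le> r\<close> assms by simp
qed

lemma X_downset: "downset Q le X"
  unfolding X_def using downset_Int A_downset C_downset by blast

lemma ex_between_extending:
  assumes G: "downset Q le G" "X \<subseteq> G" "G \<subseteq> A" and H: "downset Q le H" "X \<subseteq> H" "H \<subseteq> C"
    and card: "card G + card H \<le> n + card X"
  obtains E where "between E" "E \<inter> A = G" "H \<subseteq> E"
proof -
  have "card X \<le> card G"
    using G finite_A card_mono finite_subset by metis
  then have "card H \<le> n + card X - card G" "n + card X - card G \<le> card C"
    using card vertex_card[OF C_vertex] by simp_all
  then obtain H' where H': "downset Q le H'" "H \<subseteq> H'" "H' \<subseteq> C" "card H' = n + card X - card G"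
    using downset_extend[OF H(1) C_downset H(3)] by blast
  have "G \<inter> H' = X"
    using G H H' unfolding X_def by blast
  then have "card (G \<union> H') = n"
    using card_Un_Int[of G H'] downset_finite G(1) H'(1) H'(4) \<open>card X \<le> card G\<close> card
    by simp
  then have "G \<union> H' \<in> V"
    using downset_Un[OF G(1) H'(1)] by (intro vertexI)
  moreover have "(G \<union> H') \<inter> A = G"
    using G H' unfolding X_def by blast
  ultimately show thesis
    using that[of "G \<union> H'"] G H' unfolding between_def by blast
qed

lemma level_first_step: "level (vs ! 1) = 1"
  using first_step_adj unfolding exch_adj_def level_def by simp

lemma first_step_minimal_in:
  assumes D: "between D" and "level D + 2 \<le> m"
  obtains s where "s \<in> D" "s \<in> vs ! 1" "minimal_in (A - C) s"
proof -
  have "vs ! 1 \<in> V"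
    using vs_vertex r_ge_2 by simp
  obtain x y where x: "A - vs ! 1 = {x}" "vs ! 1 - A = {y}" "maximal_in A x"
    by (rule exch_adj_downsetE[OF A_downset vertex_downset[OF \<open>vs ! 1 \<in> V\<close>] first_step_adj])
  have "2 \<le> card (D \<inter> (A - C))"
    using card_Int_A_Diff_C_between[OF D] \<open>level D + 2 \<le> m\<close> by simp
  have "D \<inter> (A - C) - {x} \<noteq> {}"
  proof
    assume "D \<inter> (A - C) - {x} = {}"
    then have "card (D \<inter> (A - C)) \<le> card {x}"
      by (intro card_mono) auto
    then show False
      using \<open>2 \<le> card (D \<inter> (A - C))\<close> by simp
  qed
  moreover have "A - C \<subseteq> Q" "\<forall>y\<in>A - C. le x y \<longrightarrow> y = x"
    using downset_subset[OF A_downset] x(3) unfolding maximal_in_def by auto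
  ultimately obtain s where s: "s \<in> D" "s \<noteq> x" "minimal_in (A - C) s"
    using minimal_in_avoiding[OF vertex_downset[OF between_vertex[OF D]]] by metis
  then have "s \<in> vs ! 1"
    using x(1) unfolding minimal_in_def by blast
  then show thesis
    using that s by blast
qed

lemma first_step_common_upper_bound:
  assumes v: "between (vs ! 1)" and D: "between D" and "level D + 2 \<le> m"
  obtains E where "between E" "between_le (vs ! 1) E" "between_le D E" "level E < m"
proof -
  let ?v = "vs ! 1"
  obtain s where s: "s \<in> D" "s \<in> ?v" "minimal_in (A - C) s"
    using first_step_minimal_in[OF D \<open>level D + 2 \<le> m\<close>] by blast
  have "s \<in> A - C" "s \<in> Q"
    using s(3) downset_subset[OF A_downset] unfolding minimal_in_def by auto
  have "A - X = A - C"
    unfolding X_def by blast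
  then have G: "downset Q le (insert s X)"
    using downset_insert[OF X_downset \<open>s \<in> Q\<close> below_minimal_subset[OF A_downset]] s(3) by simp
  have "card (insert s X) = Suc (card X)"
    using \<open>s \<in> A - C\<close> finite_A unfolding X_def by simp
  let ?H = "(D \<inter> C) \<union> (?v \<inter> C - X)"
  have "?H = (D \<inter> C) \<union> (?v \<inter> C)"
    using D unfolding between_def X_def by blast
  moreover have "downset Q le ((D \<inter> C) \<union> (?v \<inter> C))"
    by (intro downset_Un downset_Int C_downset vertex_downset between_vertex D v)
  ultimately have H: "downset Q le ?H"
    by simp
  have "card (?v \<inter> C - X) = 1"
    using between_card_Int_C[OF v] level_first_step v finite_C
    by (simp add: card_Diff_subset between_def X_def finite_subset)
  then have "card ?H \<le> card X + level D + 1"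
    using card_Un_le[of "D \<inter> C" "?v \<inter> C - X"] between_card_Int_C[OF D] by simp
  then have "card (insert s X) + card ?H \<le> n + card X"
    using \<open>card (insert s X) = Suc (card X)\<close> card_X \<open>level D + 2 \<le> m\<close> by simp
  then obtain E where E: "between E" "E \<inter> A = insert s X" "?H \<subseteq> E"
    using ex_between_extending[OF G _ _ H] \<open>s \<in> A - C\<close> D unfolding between_def X_def by blast
  have "level E < m"
    using between_card_Int_A[OF E(1)] E(2) \<open>card (insert s X) = Suc (card X)\<close> card_X by simp
  moreover have "between_le ?v E" "between_le D E"
    unfolding between_le_def E(2)
    using s(1,2) \<open>s \<in> A - C\<close> D v E(3) unfolding between_def X_def by blast+
  ultimately show thesis
    using that E(1) by blast
qed

lemma between_class_beta:
  assumes v: "between (vs ! 1)" and D: "between D" and "0 < level D" "level D + 2 \<le> m"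
  shows "iso_class D = \<beta>"
proof -
  obtain E where E: "between E" "between_le (vs ! 1) E" "between_le D E" "level E < m"
    using first_step_common_upper_bound[OF v D \<open>level D + 2 \<le> m\<close>] by blast
  have "iso_class E = \<beta>"
    using between_le_class_eq[OF v E(1,2) _ E(4)] level_first_step unfolding \<beta>_def by simp
  then show ?thesis
    using between_le_class_eq[OF D E(1,3) \<open>0 < level D\<close> E(4)] by simp
qed

lemma beta_exchange_height:
  assumes D: "between D" "iso_class D = \<beta>" "0 < level D" "Suc (level D) < m"
    and u: "maximal_in D u" "u \<notin> C" and t: "t \<in> C" "t \<notin> D"
    and below_t: "below t \<subseteq> insert t (D - {u})"
  shows "height u = height t" "between (insert t (D - {u}))"
    "iso_class (insert t (D - {u})) = \<beta>" "level (insert t (D - {u})) = Suc (level D)"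
proof -
  let ?D' = "insert t (D - {u})"
  note D' = between_exchange[OF D(1) u t below_t]
  show "between ?D'" "level ?D' = Suc (level D)"
    using D' by simp_all
  have "iso_class D = iso_class ?D'"
    using between_le_class_eq[OF D(1) D'(1) D'(4) D(3)] D'(2) D(2,4) by simp
  then show "iso_class ?D' = \<beta>"
    using D(2) by simp
  have "comparable_pairs D le = comparable_pairs ?D' le"
    using iso_class_comparable_pairs between_vertex D(1) D'(1) \<open>iso_class D = iso_class ?D'\<close> by blast
  moreover have "t \<in> Q"
    using t(1) downset_subset[OF C_downset] by blast
  ultimately show "height u = height t"
    using exchange_height_eq[OF vertex_downset[OF between_vertex[OF D(1)]] u(1) _ t(2) below_t] by blast
qed

lemma covering_start_vertex:
  assumes in_AC: "a \<in> A - C" "a' \<in> A - C" "z \<in> A - C" "w \<in> A - C"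
    and "covers Q le a' a" "z \<noteq> a'" "\<not> le a z" "\<not> le w a'" "\<not> le w z"
  obtains D where "between D" "D \<inter> A = A \<inter> (C \<union> below a' \<union> below z)" "0 < level D" "level D + 3 \<le> m"
proof -
  let ?G = "A \<inter> (C \<union> below a' \<union> below z)"
  have Q: "a \<in> Q" "a' \<in> Q" "z \<in> Q" "w \<in> Q"
    using in_AC downset_subset[OF A_downset] by auto
  have G: "downset Q le ?G"
    by (intro downset_Int downset_Un A_downset C_downset downset_below Q)
  have "X \<subseteq> ?G" "?G \<subseteq> A"
    unfolding X_def by auto
  moreover have "card ?G \<le> n"
    using vertex_card[OF A_vertex] finite_A by (metis Int_lower1 card_mono)
  moreover have "X \<subseteq> C"
    unfolding X_def by blast
  ultimately obtain D where D: "between D" "D \<inter> A = ?G"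
    using ex_between_extending[OF G _ _ X_downset order_refl] by (metis add_le_mono1)
  have "a \<noteq> a'" "le a a'"
    using \<open>covers Q le a' a\<close> unfolding covers_def by auto
  moreover have "a \<noteq> z"
    using \<open>\<not> le a z\<close> poset_refl Q by blast
  moreover have "insert a (insert a' (insert z X)) \<subseteq> ?G"
    using in_AC Q \<open>le a a'\<close> poset_refl unfolding X_def below_def by auto
  moreover have "finite X" "a \<notin> X" "a' \<notin> X" "z \<notin> X"
    using finite_A in_AC unfolding X_def by auto
  ultimately have "card X + 3 \<le> card ?G"
    using card_mono[of ?G "insert a (insert a' (insert z X))"] finite_A \<open>z \<noteq> a'\<close> by simp
  moreover have "card ?G < n"
  proof -
    have "w \<notin> ?G"
      using in_AC \<open>\<not> le w a'\<close> \<open>\<not> le w z\<close> unfolding below_def by auto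
    then have "?G \<subset> A"
      using in_AC by blast
    then show ?thesis
      using psubset_card_mono finite_A vertex_card[OF A_vertex] by metis
  qed
  ultimately show thesis
    using that[OF D] between_card_Int_A[OF D(1)] D(2) card_X by simp
qed

lemma no_covering_configuration:
  assumes v: "between (vs ! 1)"
    and in_AC: "a \<in> A - C" "a' \<in> A - C" "z \<in> A - C" "w \<in> A - C"
    and cover: "covers Q le a' a" and "z \<noteq> a'" "\<not> le a z" "\<not> le w a'" "\<not> le w z"
  shows False
proof -
  obtain D1 where D1: "between D1" "D1 \<inter> A = A \<inter> (C \<union> below a' \<union> below z)"
    "0 < level D1" "level D1 + 3 \<le> m"
    using covering_start_vertex[OF in_AC assms(6-10)] by blast
  have Q: "a \<in> Q" "a' \<in> Q" "z \<in> Q" and "le a a'" "a \<noteq> a'"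
    using in_AC downset_subset[OF A_downset] cover unfolding covers_def by auto
  have "D1 \<subseteq> Q" "a \<in> D1" "a' \<in> D1" "\<forall>y\<in>D1 - C. le y a' \<or> le y z"
    using D1(1,2) in_AC Q \<open>le a a'\<close> poset_refl vertex_downset downset_subset
    unfolding between_def below_def by blast+
  note maximal = covering_exchange_maximal[OF C_downset _ _ cover \<open>\<not> le a z\<close> Q(3) this]
  have "iso_class D1 = \<beta>"
    using between_class_beta[OF v D1(1,3)] D1(4) by simp
  have "2 \<le> card (C - D1)"
    using card_C_Diff_between[OF D1(1)] D1(4) by simp
  then obtain t1 t2 where t: "minimal_in (C - D1) t1" "minimal_in (C - D1 - {t1}) t2"
    "height t1 \<le> height t2"
    using ex_two_least_height[of "C - D1"] downset_subset[OF C_downset] by blast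
  have "C - D1 - {t1} = C - insert t1 D1"
    by blast
  note t = t(1) t(2)[unfolded this] t(3)
  then have "t1 \<in> C - D1" "t2 \<in> C - insert t1 D1"
    unfolding minimal_in_def by auto
  have "below t1 \<subseteq> insert t1 (D1 - {a'})" "below t2 \<subseteq> insert t2 (insert t1 (D1 - {a'}) - {a})"
    using below_minimal_subset[OF C_downset t(1)] below_minimal_subset[OF C_downset t(2)]
      below_subset_downset[OF C_downset] \<open>t1 \<in> C - D1\<close> \<open>t2 \<in> C - insert t1 D1\<close> in_AC by blast+
  define D2 where "D2 = insert t1 (D1 - {a'})"
  have step1: "height a' = height t1" "between D2" "iso_class D2 = \<beta>" "level D2 = Suc (level D1)"
    using beta_exchange_height[OF D1(1) \<open>iso_class D1 = \<beta>\<close> D1(3) _ maximal(1)] D1(4) in_AC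
      \<open>t1 \<in> C - D1\<close> \<open>below t1 \<subseteq> insert t1 (D1 - {a'})\<close> unfolding D2_def by auto
  have "height a = height t2"
    using beta_exchange_height(1)[OF step1(2,3) _ _ maximal(2)[of t1, folded D2_def]] step1(4) D1(4)
      in_AC \<open>t1 \<in> C - D1\<close> \<open>t2 \<in> C - insert t1 D1\<close> \<open>below t2 \<subseteq> _\<close> unfolding D2_def by auto
  moreover have "height a < height a'"
    using height_strict_mono Q \<open>le a a'\<close> \<open>a \<noteq> a'\<close> by blast
  ultimately show False
    using step1(1) t(3) by simp
qed

theorem no_bad_partition: "\<not> bad_partition Q le (A - X)"
proof
  assume "bad_partition Q le (A - X)"
  moreover have "A - X = A - C" "A - C \<subseteq> Q"
    unfolding X_def using downset_subset[OF A_downset] by auto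
  ultimately obtain a a' z w where in_AC: "a \<in> A - C" "a' \<in> A - C" "z \<in> A - C" "w \<in> A - C"
    and rest: "covers Q le a' a" "z \<noteq> a'" "\<not> le a z" "\<not> le w a'" "\<not> le w z"
    using bad_partition_witnesses by metis
  have "card {a, a'} \<le> m"
    unfolding m_def using in_AC finite_A by (intro card_mono) auto
  then have "2 \<le> m"
    using rest(1) unfolding covers_def by auto
  then show False
    using no_covering_configuration[OF first_step_between in_AC rest] by blast
qed

end

theorem mainTheorem16:
  fixes Q :: "'a set" and le :: "'a \<Rightarrow> 'a \<Rightarrow> bool" and n :: nat
    and \<Gamma> :: "('b set \<times> ('b \<Rightarrow> 'b \<Rightarrow> bool)) set" and vs :: "'a set list"
    and A C X :: "'a set"
  assumes finQ: "finite Q"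
    and posQ: "is_poset Q le"
    and card\<Gamma>: "card \<Gamma> = 3"
    and \<Gamma>_posets: "\<forall>P\<in>\<Gamma>. finite (fst P) \<and> card (fst P) = n \<and> is_poset (fst P) (snd P)"
    and \<Gamma>_noniso: "\<forall>P\<in>\<Gamma>. \<forall>P'\<in>\<Gamma>. P \<noteq> P' \<longrightarrow> \<not> ord_iso (fst P) (snd P) (fst P') (snd P')"
    and wit: "is_witness Q le n \<Gamma>"
    and sp: "special_path Q le n \<Gamma> vs"
    and minimal: "\<forall>ws. special_path Q le n \<Gamma> ws \<longrightarrow> length vs \<le> length ws"
    and Q_union: "Q = \<Union> (set vs)"
    and A_def: "A = hd vs" and C_def: "C = last vs" and X_def: "X = A \<inter> C"
  shows "\<not> bad_partition Q le (A - X) \<and> \<not> bad_partition Q le (C - X)"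
proof -
  interpret fwd: minimal_special_path Q le n \<Gamma> vs
    by unfold_locales (use finQ posQ \<Gamma>_noniso wit sp minimal in auto)
  interpret bwd: minimal_special_path Q le n \<Gamma> "rev vs"
    by unfold_locales (use finQ posQ \<Gamma>_noniso wit special_path_rev[OF sp] minimal in auto)
  have "vs \<noteq> []"
    using sp unfolding special_path_def by auto
  then have "fwd.A - fwd.X = A - X" "bwd.A - bwd.X = C - X"
    unfolding fwd.A_def fwd.C_def fwd.X_def bwd.A_def bwd.C_def bwd.X_def A_def C_def X_def
    by (auto simp: hd_rev last_rev)
  then show ?thesis
    using fwd.no_bad_partition bwd.no_bad_partition by simp
qed

end
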